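(* Let $G=(V,E,\nu,\mu)$ be a weighted graph, let $\Omega$ be a finite connected bipartite subgraph of $G$, and let $p\in(1,\infty)$. Let $f$ be an eigenfunction of the Dirichlet $p$-Laplacian on $\Omega$. Then $f$ is a maximum eigenfunction if and only if $f(x)f(y)<0$ for all $x,y\in\Omega$ with $x\sim y$. Moreover, the maximum eigenfunction is unique up to multiplication by constants.
   Context: A weighted graph $G=(V,E,\nu,\mu)$ consists of a locally finite, simple, undirected graph $(V,E)$, an edge weight $\mu:E\to(0,\infty)$, $\{x,y\}\mapsto\mu_{xy}=\mu_{yx}$, extended by $\mu_{xy}=0$ if $\{x,y\}\notin E$, and a vertex measure $\nu:V\to(0,\infty)$, $x\mapsto\nu_x$. Write $x\sim y$ if $\{x,y\}\in E$. A nonempty finite $\Omega\subset V$ is identified with the subgraph of $G$ induced on it; it is connected if this induced subgraph is connected, and bipartite if $\Omega$ can be split into two disjoint subsets $V_1,V_2$ such that every edge of the induced subgraph connects a vertex in $V_1$ to one in $V_2$. $\mathbb{R}^\Omega$ is the set of functions $\Omega\to\mathbb{R}$; for $u\in\mathbb{R}^\Omega$, $\bar u\in\mathbb{R}^V$ is the extension of $u$ by $0$ to $V$. For $p\in(1,\infty)$ the Dirichlet $p$-Laplacian on $\Omega$ is $$\Delta_p u(x)=\frac1{\nu_x}\sum_{y\in V}\mu_{xy}|\bar u(y)-\bar u(x)|^{p-2}(\bar u(y)-\bar u(x)),\quad x\in\Omega,$$ with the convention $|0|^{p-2}0=0$. A function $f\in\mathbb{R}^\Omega$, $f\not\equiv0$,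 is an eigenfunction pertaining to the eigenvalue $\lambda\in\mathbb{R}$ if $\Delta_p f=-\lambda|f|^{p-2}f$ on $\Omega$. Let $E_p(u)=\frac12\sum_{x,y\in V,\,x\sim y}|\bar u(y)-\bar u(x)|^p\mu_{xy}$ (sum over ordered pairs) and $\|u\|_{p,\Omega}^p=\sum_{x\in\Omega}|u(x)|^p\nu_x$. The maximum (largest) eigenvalue is $\lambda_{m,p}(\Omega)=\sup_{u\in\mathbb{R}^\Omega,u\not\equiv0}E_p(u)/\|u\|_{p,\Omega}^p$. A maximum eigenfunction is an eigenfunction pertaining to $\lambda_{m,p}(\Omega)$. *)

theory Defs
  imports "HOL-Analysis.Analysis"
begin

record 'v wgraph =
  verts :: "'v set"
  edges :: "'v set set"
  emu :: "'v \<Rightarrow> 'v \<Rightarrow> real"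
  vnu :: "'v \<Rightarrow> real"

definition adj :: "'v wgraph \<Rightarrow> 'v \<Rightarrow> 'v \<Rightarrow> bool" where
  "adj G x y \<longleftrightarrow> {x, y} \<in> edges G"

text \<open>The edge weight is given directly as its extension by zero to all pairs of vertices.\<close>

definition weighted_graph :: "'v wgraph \<Rightarrow> bool" where
  "weighted_graph G \<longleftrightarrow>
     (\<forall>e \<in> edges G. e \<subseteq> verts G \<and> card e = 2) \<and>
     (\<forall>x \<in> verts G. finite {y \<in> verts G. adj G x y}) \<and>
     (\<forall>x \<in> verts G. \<forall>y \<in> verts G. emu G x y = emu G y x) \<and>
     (\<forall>x \<in> verts G. \<forall>y \<in> verts G. adj G x y \<longrightarrow> emu G x y > 0) \<and>
     (\<forall>x \<in> verts G. \<forall>y \<in> verts G. \<not> adj G x y \<longrightarrow> emu G x y = 0) \<and>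
     (\<forall>x \<in> verts G. vnu G x > 0)"

definition connected_in :: "'v wgraph \<Rightarrow> 'v set \<Rightarrow> bool" where
  "connected_in G \<Omega> \<longleftrightarrow>
     (\<forall>x \<in> \<Omega>. \<forall>y \<in> \<Omega>. (x, y) \<in> {(a, b). a \<in> \<Omega> \<and> b \<in> \<Omega> \<and> adj G a b}\<^sup>*)"

definition bipartite_in :: "'v wgraph \<Rightarrow> 'v set \<Rightarrow> bool" where
  "bipartite_in G \<Omega> \<longleftrightarrow>
     (\<exists>V1 V2. V1 \<union> V2 = \<Omega> \<and> V1 \<inter> V2 = {} \<and>
        (\<forall>x \<in> \<Omega>. \<forall>y \<in> \<Omega>. adj G x y \<longrightarrow>
           (x \<in> V1 \<and> y \<in> V2) \<or> (x \<in> V2 \<and> y \<in> V1)))"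

text \<open>
  A function on \<open>\<Omega>\<close> is represented by a total function of which only the values on \<open>\<Omega>\<close>
  are used: every notion below depends on \<open>u\<close> through its restriction to \<open>\<Omega>\<close> only.
\<close>

definition zero_ext :: "'v set \<Rightarrow> ('v \<Rightarrow> real) \<Rightarrow> 'v \<Rightarrow> real" where
  "zero_ext \<Omega> u x = (if x \<in> \<Omega> then u x else 0)"

definition nonzero_on :: "'v set \<Rightarrow> ('v \<Rightarrow> real) \<Rightarrow> bool" where
  "nonzero_on \<Omega> u \<longleftrightarrow> (\<exists>x \<in> \<Omega>. u x \<noteq> 0)"

text \<open>
  Since \<open>V\<close> may be infinite, sums over \<open>V\<close> are written with \<^const>\<open>infsum\<close>. For a finite
  \<open>\<Omega> \<subseteq> V\<close> they have only finitely many nonzero terms, by local finiteness.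
  As \<open>0 powr a = 0\<close>, the convention \<open>|0|\<^sup>p\<^sup>-\<^sup>2 0 = 0\<close> holds automatically.
\<close>

definition p_laplacian :: "'v wgraph \<Rightarrow> 'v set \<Rightarrow> real \<Rightarrow> ('v \<Rightarrow> real) \<Rightarrow> 'v \<Rightarrow> real" where
  "p_laplacian G \<Omega> p u x =
     1 / vnu G x *
     (\<Sum>\<^sub>\<infinity>y\<in>verts G. emu G x y *
        \<bar>zero_ext \<Omega> u y - zero_ext \<Omega> u x\<bar> powr (p - 2) * (zero_ext \<Omega> u y - zero_ext \<Omega> u x))"

definition eigenfunction_for ::
    "'v wgraph \<Rightarrow> 'v set \<Rightarrow> real \<Rightarrow> real \<Rightarrow> ('v \<Rightarrow> real) \<Rightarrow> bool" where
  "eigenfunction_for G \<Omega> p lam f \<longleftrightarrow>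
     nonzero_on \<Omega> f \<and>
     (\<forall>x \<in> \<Omega>. p_laplacian G \<Omega> p f x = - lam * \<bar>f x\<bar> powr (p - 2) * f x)"

definition eigenfunction :: "'v wgraph \<Rightarrow> 'v set \<Rightarrow> real \<Rightarrow> ('v \<Rightarrow> real) \<Rightarrow> bool" where
  "eigenfunction G \<Omega> p f \<longleftrightarrow> (\<exists>lam. eigenfunction_for G \<Omega> p lam f)"

definition p_energy :: "'v wgraph \<Rightarrow> 'v set \<Rightarrow> real \<Rightarrow> ('v \<Rightarrow> real) \<Rightarrow> real" where
  "p_energy G \<Omega> p u =
     1 / 2 * (\<Sum>\<^sub>\<infinity>(x, y)\<in>{(x, y). x \<in> verts G \<and> y \<in> verts G \<and> adj G x y}.
       \<bar>zero_ext \<Omega> u y - zero_ext \<Omega> u x\<bar> powr p * emu G x y)"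

definition p_norm_pow :: "'v wgraph \<Rightarrow> 'v set \<Rightarrow> real \<Rightarrow> ('v \<Rightarrow> real) \<Rightarrow> real" where
  "p_norm_pow G \<Omega> p u = (\<Sum>x\<in>\<Omega>. \<bar>u x\<bar> powr p * vnu G x)"

definition max_eigenvalue :: "'v wgraph \<Rightarrow> 'v set \<Rightarrow> real \<Rightarrow> real" where
  "max_eigenvalue G \<Omega> p =
     (SUP u \<in> {u. nonzero_on \<Omega> u}. p_energy G \<Omega> p u / p_norm_pow G \<Omega> p u)"

definition max_eigenfunction :: "'v wgraph \<Rightarrow> 'v set \<Rightarrow> real \<Rightarrow> ('v \<Rightarrow> real) \<Rightarrow> bool" where
  "max_eigenfunction G \<Omega> p f \<longleftrightarrow> eigenfunction_for G \<Omega> p (max_eigenvalue G \<Omega> p) f"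

end

theory Submission
  imports Defs
begin

text \<open>
  Multiplying a function by \<open>-1\<close> on one of the two classes of the bipartition turns every
  difference \<open>f y - f x\<close> along an edge inside \<open>\<Omega>\<close> into a sum \<open>u x + u y\<close>, up to sign, and
  leaves \<open>\<bar>f x\<bar>\<close> unchanged. The edges leaving \<open>\<Omega>\<close> contribute only multiples of
  \<open>\<bar>f x\<bar> powr p\<close>. Hence the maximum problem becomes that of a signless energy
  \<open>1/2 \<Sum> w x y \<bar>u x + u y\<bar>\<^sup>p + \<Sum> \<kappa> x \<bar>u x\<bar>\<^sup>p\<close>, and the condition
  \<open>f x f y < 0\<close> along edges says that \<open>u\<close> keeps its sign along edges, so that, \<open>\<Omega>\<close> being
  connected, \<open>u\<close> is of one sign. The theorem is thus a Perron-Frobenius statement: up to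
  multiples there is exactly one solution of one sign, and it is the maximizer.

  Existence: the unit sphere of the finite-dimensional space of functions is compact, so a
  maximizer of the Rayleigh quotient exists. Taking absolute values does not decrease the
  signless energy, so there is a nonnegative maximizer; it solves the eigenvalue equation by the
  first variation (\<open>maximizer_solves\<close>), and it is strictly positive because a zero of a
  nonnegative solution spreads to all neighbours (\<open>nonneg_solution_pos\<close>).

  Uniqueness: let \<open>u > 0\<close> solve the equation for \<open>lam\<close>. Testing the equation with
  \<open>\<bar>v\<bar>\<^sup>p / u\<^sup>p\<^sup>-\<^sup>1\<close> expresses \<open>lam * mass v - energy v\<close> as a weighted sum of the gaps in
  \<open>\<bar>s + t\<bar>\<^sup>p \<le> (a + b)\<^sup>p\<^sup>-\<^sup>1 (\<bar>s\<bar>\<^sup>p / a\<^sup>p\<^sup>-\<^sup>1 + \<bar>t\<bar>\<^sup>p / b\<^sup>p\<^sup>-\<^sup>1)\<close>, which is Jensen's inequality for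
  the strictly convex function \<open>x\<^sup>p\<close> (\<open>picone_pair\<close>, \<open>picone_identity\<close>). So \<open>lam\<close> is
  the maximum, whatever positive solution it comes from. If \<open>v\<close> is another maximizer, all gaps
  vanish, which forces \<open>v / u\<close> to be constant along edges, hence on \<open>\<Omega>\<close>
  (\<open>maximizer_proportional\<close>).
\<close>

section \<open>Signed powers and a Picone inequality for pairs\<close>

text \<open>
  The nonlinearity of the p-Laplacian; \<open>p * spow p\<close> is, for \<open>p > 1\<close>, the derivative of
  \<open>\<bar>t\<bar> powr p\<close>, also at \<open>t = 0\<close>.
\<close>

definition spow :: "real \<Rightarrow> real \<Rightarrow> real" where
  "spow p t = \<bar>t\<bar> powr (p - 2) * t"

lemma spow_minus: "spow p (- t) = - spow p t"
  by (simp add: spow_def)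

lemma spow_zero [simp]: "spow p 0 = 0"
  by (simp add: spow_def)

lemma spow_mult_self: "spow p t * t = \<bar>t\<bar> powr p"
proof (cases "t = 0")
  case False
  have "spow p t * t = \<bar>t\<bar> powr (p - 2) * (\<bar>t\<bar> * \<bar>t\<bar>)"
    by (simp add: spow_def)
  also have "\<dots> = \<bar>t\<bar> powr (p - 2) * \<bar>t\<bar> powr 2"
    using False by (simp add: power2_eq_square)
  also have "\<dots> = \<bar>t\<bar> powr p"
    by (subst powr_add[symmetric]) simp
  finally show ?thesis .
qed simp

lemma spow_pos:
  assumes "t > 0" shows "spow p t = t powr (p - 1)"
proof -
  have "spow p t = t powr (p - 2) * t powr 1"
    using assms by (simp add: spow_def)
  also have "\<dots> = t powr (p - 1)"
    by (subst powr_add[symmetric]) simp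
  finally show ?thesis .
qed

lemma DERIV_abs_powr:
  assumes "1 < p"
  shows "((\<lambda>t. \<bar>t\<bar> powr p) has_real_derivative p * spow p t) (at t)"
proof -
  consider "t > 0" | "t < 0" | "t = 0" by linarith
  then show ?thesis
  proof cases
    case 1
    have "((\<lambda>t. t powr p) has_real_derivative p * t powr (p - 1)) (at t)"
      using 1 by (auto intro!: derivative_eq_intros)
    then have "((\<lambda>t. \<bar>t\<bar> powr p) has_real_derivative p * t powr (p - 1)) (at t)"
      by (rule has_field_derivative_transform_within_open[where S = "{0<..}"]) (use 1 in auto)
    then show ?thesis using 1 by (simp add: spow_pos)
  next
    case 2
    have "((\<lambda>t. (-t) powr p) has_real_derivative - (p * (-t) powr (p - 1))) (at t)"
      using 2 by (auto intro!: derivative_eq_intros)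
    then have "((\<lambda>t. \<bar>t\<bar> powr p) has_real_derivative - (p * (-t) powr (p - 1))) (at t)"
      by (rule has_field_derivative_transform_within_open[where S = "{..<0}"]) (use 2 in auto)
    moreover have "spow p t = - ((-t) powr (p - 1))"
      using 2 spow_pos[of "-t" p] by (simp add: spow_minus)
    ultimately show ?thesis by simp
  next
    case 3
    \<comment> \<open>The difference quotient at \<open>0\<close> has modulus \<open>\<bar>h\<bar> powr (p - 1)\<close>, and \<open>p > 1\<close>.\<close>
    have "((\<lambda>h. \<bar>h\<bar> powr (p - 1)) \<longlongrightarrow> 0) (at (0::real))"
      using assms by (intro tendsto_eq_intros tendsto_zero_powrI) (auto intro!: tendsto_eq_intros)
    then have "((\<lambda>h. \<bar>h\<bar> powr p / h) \<longlongrightarrow> 0) (at (0::real))"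
    proof (rule Lim_null_comparison[rotated])
      have "norm (\<bar>h\<bar> powr p / h) = \<bar>h\<bar> powr (p - 1)" if "h \<noteq> 0" for h :: real
        using that by (simp add: powr_diff)
      then show "\<forall>\<^sub>F h in at 0. norm (\<bar>h\<bar> powr p / h) \<le> \<bar>h\<bar> powr (p - 1)"
        by (intro always_eventually allI) (metis abs_ge_zero div_by_0 norm_zero order_refl powr_ge_zero)
    qed
    then show ?thesis
      using 3 assms by (simp add: DERIV_def)
  qed
qed

lemma DERIV_abs_powr_line:
  assumes "1 < p"
  shows "((\<lambda>t. \<bar>a + t * c\<bar> powr p) has_real_derivative p * spow p a * c) (at 0)"
proof -
  have "((\<lambda>t. \<bar>t\<bar> powr p) has_real_derivative p * spow p a) (at (a + 0 * c))"
    using DERIV_abs_powr[OF assms, of a] by simp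
  moreover have "((\<lambda>t. a + t * c) has_real_derivative c) (at 0)"
    by (auto intro!: derivative_eq_intros)
  ultimately show ?thesis
    by (rule DERIV_chain2[where g = "\<lambda>t. a + t * c"])
qed

text \<open>
  Strict convexity of \<open>x powr p\<close>, in the form of its tangent at \<open>1\<close>: the difference of the two
  sides strictly decreases before \<open>1\<close> and strictly increases after it. The strictness is what
  the uniqueness of the maximizer rests on.
\<close>

lemma powr_above_tangent:
  fixes x p :: real
  assumes "1 < p" "0 \<le> x" "x \<noteq> 1"
  shows "1 + p * (x - 1) < x powr p"
proof -
  let ?g = "\<lambda>x. x powr p - p * x"
  have deriv: "(?g has_real_derivative p * (t powr (p - 1) - 1)) (at t)" if "t > 0" for t
    using that by (auto intro!: derivative_eq_intros simp: algebra_simps)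
  have cont: "continuous_on {a..b} ?g" if "0 \<le> a" for a b
    using that assms(1)
    by (intro continuous_on_diff continuous_on_powr' continuous_intros) auto
  have "?g 1 < ?g x"
  proof (cases "x < 1")
    case True
    show ?thesis
    proof (rule DERIV_neg_imp_decreasing_open[OF True])
      fix t assume t: "x < t" "t < 1"
      then have "t powr (p - 1) < 1"
        using assms powr_less_mono2[of "p - 1" t 1] by simp
      then have "p * (t powr (p - 1) - 1) < 0"
        using assms by (simp add: mult_pos_neg)
      then show "\<exists>y. (?g has_real_derivative y) (at t) \<and> y < 0"
        using deriv[of t] t assms by auto
    qed (use cont assms in auto)
  next
    case False
    then have "1 < x" using assms by simp
    then show ?thesis
    proof (rule DERIV_pos_imp_increasing_open)
      fix t assume t: "1 < t" "t < x"
      then have "1 < t powr (p - 1)"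
        using assms powr_less_mono2[of "p - 1" 1 t] by simp
      then have "p * (t powr (p - 1) - 1) > 0"
        using assms by simp
      then show "\<exists>y. (?g has_real_derivative y) (at t) \<and> y > 0"
        using deriv[of t] t by auto
    qed (use cont in auto)
  qed
  then show ?thesis by (simp add: algebra_simps)
qed

lemma powr_tangent_at:
  fixes x m p :: real
  assumes "1 < p" "0 \<le> x" "0 < m" "x \<noteq> m"
  shows "m powr p + p * m powr (p - 1) * (x - m) < x powr p"
proof -
  have "1 + p * (x / m - 1) < (x / m) powr p"
    using assms by (intro powr_above_tangent) auto
  then have "m powr p * (1 + p * (x / m - 1)) < m powr p * (x / m) powr p"
    using assms by (intro mult_strict_left_mono) auto
  moreover have "m powr p * (x / m) powr p = x powr p"
    using assms by (simp add: powr_divide)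
  moreover have "m powr p * (1 + p * (x / m - 1)) = m powr p + p * m powr (p - 1) * (x - m)"
    using assms by (simp add: powr_diff field_simps)
  ultimately show ?thesis by simp
qed

text \<open>
  With the weights \<open>a / (a + b)\<close> and \<open>b / (a + b)\<close>, the mean of \<open>s / a\<close> and \<open>t / b\<close> is
  \<open>m = (s + t) / (a + b)\<close>, so this is Jensen's inequality for \<open>x powr p\<close>. The proof adds the
  tangent inequalities at \<open>m\<close>, in which the linear terms cancel; equality forces
  \<open>s / a = m = t / b\<close>.
\<close>

lemma picone_nonneg:
  fixes a b s t p :: real
  assumes "1 < p" "0 < a" "0 < b" "0 \<le> s" "0 \<le> t"
  defines "R \<equiv> (a + b) powr (p - 1) * (s powr p / a powr (p - 1) + t powr p / b powr (p - 1))"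
  shows "(s + t) powr p \<le> R" and "(s + t) powr p = R \<Longrightarrow> s * b = t * a"
proof -
  have "(s + t) powr p \<le> R \<and> (s * b \<noteq> t * a \<longrightarrow> (s + t) powr p < R)"
  proof (cases "s + t = 0")
    case True
    then have "s = 0" "t = 0" using assms by auto
    then show ?thesis using assms by (simp add: R_def)
  next
    case False
    define m where "m = (s + t) / (a + b)"
    have m: "m > 0" using False assms by (simp add: m_def)
    have ab: "a + b > 0" using assms by simp
    \<comment> \<open>\<open>X\<close> and \<open>Y\<close> are the heights of the graph above its tangent at \<open>m\<close>.\<close>
    define X where "X = (s / a) powr p - (m powr p + p * m powr (p - 1) * (s / a - m))"
    define Y where "Y = (t / b) powr p - (m powr p + p * m powr (p - 1) * (t / b - m))"
    have X: "X \<ge> 0" "s / a \<noteq> m \<Longrightarrow> X > 0"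
      using powr_tangent_at[of p "s / a" m] assms m by (cases "s / a = m"; force simp: X_def)+
    have Y: "Y \<ge> 0" "t / b \<noteq> m \<Longrightarrow> Y > 0"
      using powr_tangent_at[of p "t / b" m] assms m by (cases "t / b = m"; force simp: Y_def)+
    have bal: "a * (s / a - m) + b * (t / b - m) = 0"
    proof -
      have "m * (a + b) = s + t" using ab by (simp add: m_def)
      then show ?thesis using assms by (simp add: algebra_simps)
    qed
    have "a * X + b * Y = a * (s / a) powr p + b * (t / b) powr p - (a + b) * m powr p
        - p * m powr (p - 1) * (a * (s / a - m) + b * (t / b - m))"
      unfolding X_def Y_def by (simp only: algebra_simps)
    also have "\<dots> = a * (s / a) powr p + b * (t / b) powr p - (a + b) * m powr p"
      by (simp add: bal)
    finally have eq: "a * X + b * Y = \<dots>" .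
    have "(a + b) powr (p - 1) * (a * (s / a) powr p + b * (t / b) powr p) = R"
      using assms by (simp add: R_def powr_divide powr_diff field_simps)
    moreover have "(a + b) powr (p - 1) * ((a + b) * m powr p) = (s + t) powr p"
      using assms ab by (simp add: m_def powr_divide powr_diff)
    ultimately have gap: "R - (s + t) powr p = (a + b) powr (p - 1) * (a * X + b * Y)"
      unfolding eq by (simp add: right_diff_distrib)
    have "s / a \<noteq> m \<or> t / b \<noteq> m" if "s * b \<noteq> t * a"
      using that assms by (auto simp: frac_eq_eq)
    then have "a * X + b * Y > 0" if "s * b \<noteq> t * a"
      using that X Y assms by (auto intro: add_pos_nonneg add_nonneg_pos)
    then have "R - (s + t) powr p > 0" if "s * b \<noteq> t * a"
      unfolding gap using that ab by simp
    moreover have "R - (s + t) powr p \<ge> 0"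
      unfolding gap using X Y assms by simp
    ultimately show ?thesis by auto
  qed
  then show "(s + t) powr p \<le> R" and "(s + t) powr p = R \<Longrightarrow> s * b = t * a"
    by auto
qed

text \<open>
  For arbitrary signs the triangle inequality comes first. In the case of equality it forces
  \<open>s\<close> and \<open>t\<close> to have the same sign, so the proportionality of the absolute values carries over
  to \<open>s\<close> and \<open>t\<close> themselves.
\<close>

lemma picone_pair:
  fixes a b s t p :: real
  assumes "1 < p" "0 < a" "0 < b"
  defines "R \<equiv> (a + b) powr (p - 1) * (\<bar>s\<bar> powr p / a powr (p - 1) + \<bar>t\<bar> powr p / b powr (p - 1))"
  shows "\<bar>s + t\<bar> powr p \<le> R" and "\<bar>s + t\<bar> powr p = R \<Longrightarrow> s * b = t * a"
proof -
  have le: "\<bar>s + t\<bar> powr p \<le> (\<bar>s\<bar> + \<bar>t\<bar>) powr p"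
    using assms by (intro powr_mono2) auto
  have R: "(\<bar>s\<bar> + \<bar>t\<bar>) powr p \<le> R"
    unfolding R_def using assms by (intro picone_nonneg) auto
  show "\<bar>s + t\<bar> powr p \<le> R" using le R by simp
  assume eq: "\<bar>s + t\<bar> powr p = R"
  have "\<bar>s\<bar> * b = \<bar>t\<bar> * a"
    by (rule picone_nonneg(2)[of p]) (use assms eq le R in \<open>auto simp: R_def\<close>)
  moreover have "\<bar>s + t\<bar> = \<bar>s\<bar> + \<bar>t\<bar>"
  proof (rule ccontr)
    assume "\<not> ?thesis"
    then have "\<bar>s + t\<bar> powr p < (\<bar>s\<bar> + \<bar>t\<bar>) powr p"
      using assms by (intro powr_less_mono2) auto
    then show False using eq R by simp
  qed
  then have "\<bar>s\<bar> = s \<and> \<bar>t\<bar> = t \<or> \<bar>s\<bar> = - s \<and> \<bar>t\<bar> = - t"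
    by linarith
  ultimately show "s * b = t * a"
    by auto
qed

section \<open>The signless energy\<close>

text \<open>
  The data left after the change of signs: edge weights \<open>w\<close> inside \<open>\<Omega>\<close>, a potential \<open>\<kappa>\<close>,
  which will be the total weight of the edges leaving \<open>\<Omega>\<close>, and a vertex
  measure \<open>\<nu>\<close>. The edges are the pairs of positive weight.
\<close>

locale signless_form =
  fixes \<Omega> :: "'v set" and w :: "'v \<Rightarrow> 'v \<Rightarrow> real" and \<kappa> \<nu> :: "'v \<Rightarrow> real" and p :: real
  assumes fin: "finite \<Omega>" and ne: "\<Omega> \<noteq> {}"
    and w_sym: "\<And>x y. x \<in> \<Omega> \<Longrightarrow> y \<in> \<Omega> \<Longrightarrow> w x y = w y x"
    and w_nonneg: "\<And>x y. x \<in> \<Omega> \<Longrightarrow> y \<in> \<Omega> \<Longrightarrow> 0 \<le> w x y"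
    and conn: "\<And>x y. x \<in> \<Omega> \<Longrightarrow> y \<in> \<Omega> \<Longrightarrow>
      (x, y) \<in> {(a, b). a \<in> \<Omega> \<and> b \<in> \<Omega> \<and> 0 < w a b}\<^sup>*"
    and nu_pos: "\<And>x. x \<in> \<Omega> \<Longrightarrow> 0 < \<nu> x"
    and p_gt: "1 < p"
begin

definition energy :: "('v \<Rightarrow> real) \<Rightarrow> real" where
  "energy u = (\<Sum>x\<in>\<Omega>. \<Sum>y\<in>\<Omega>. w x y * \<bar>u x + u y\<bar> powr p) / 2 + (\<Sum>x\<in>\<Omega>. \<kappa> x * \<bar>u x\<bar> powr p)"

definition mass :: "('v \<Rightarrow> real) \<Rightarrow> real" where
  "mass u = (\<Sum>x\<in>\<Omega>. \<nu> x * \<bar>u x\<bar> powr p)"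

text \<open>
  The gradient of \<open>energy\<close> divided by \<open>p\<close>, as \<open>first_variation\<close> shows. Correspondingly
  \<open>\<nu> x * spow p (u x)\<close> is the gradient of \<open>mass\<close> divided by \<open>p\<close>, and \<open>solves lam u\<close> is the
  Euler-Lagrange equation of the Rayleigh quotient.
\<close>

definition grad :: "('v \<Rightarrow> real) \<Rightarrow> 'v \<Rightarrow> real" where
  "grad u x = (\<Sum>y\<in>\<Omega>. w x y * spow p (u x + u y)) + \<kappa> x * spow p (u x)"

definition solves :: "real \<Rightarrow> ('v \<Rightarrow> real) \<Rightarrow> bool" where
  "solves lam u \<longleftrightarrow> (\<forall>x\<in>\<Omega>. grad u x = lam * \<nu> x * spow p (u x))"

lemma edge_propagation:
  assumes "x \<in> \<Omega>" "y \<in> \<Omega>" "P x"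
    and "\<And>a b. a \<in> \<Omega> \<Longrightarrow> b \<in> \<Omega> \<Longrightarrow> 0 < w a b \<Longrightarrow> P a \<Longrightarrow> P b"
  shows "P y"
  using conn[OF assms(1,2)] by (induction rule: rtrancl_induct) (use assms in auto)

lemma sum_symmetrize:
  fixes c :: "'v \<Rightarrow> 'v \<Rightarrow> real"
  assumes "\<And>x y. x \<in> \<Omega> \<Longrightarrow> y \<in> \<Omega> \<Longrightarrow> c x y = c y x"
  shows "(\<Sum>x\<in>\<Omega>. \<Sum>y\<in>\<Omega>. c x y * (d x + d y)) / 2 = (\<Sum>x\<in>\<Omega>. d x * (\<Sum>y\<in>\<Omega>. c x y))"
proof -
  have "(\<Sum>x\<in>\<Omega>. \<Sum>y\<in>\<Omega>. c x y * d y) = (\<Sum>y\<in>\<Omega>. \<Sum>x\<in>\<Omega>. c x y * d y)"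
    by (rule sum.swap)
  also have "\<dots> = (\<Sum>x\<in>\<Omega>. \<Sum>y\<in>\<Omega>. c x y * d x)"
    using assms by (intro sum.cong refl) auto
  finally show ?thesis
    by (simp add: distrib_left sum.distrib sum_distrib_left mult.commute)
qed

text \<open>
  Summation by parts, with a test function \<open>d\<close>. It is used for \<open>d = u\<close> (\<open>energy_solution\<close>), for
  an arbitrary variation (\<open>first_variation\<close>) and for \<open>d = \<bar>v\<bar>\<^sup>p / u\<^sup>p\<^sup>-\<^sup>1\<close>
  (\<open>picone_identity\<close>).
\<close>

lemma weak_form:
  "(\<Sum>x\<in>\<Omega>. \<Sum>y\<in>\<Omega>. w x y * spow p (u x + u y) * (d x + d y)) / 2
     + (\<Sum>x\<in>\<Omega>. \<kappa> x * spow p (u x) * d x) = (\<Sum>x\<in>\<Omega>. d x * grad u x)"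
  by (subst sum_symmetrize)
    (auto simp: w_sym add.commute grad_def distrib_left sum.distrib mult_ac)

lemma energy_solution:
  assumes "solves lam u"
  shows "energy u = lam * mass u"
proof -
  have "energy u = (\<Sum>x\<in>\<Omega>. u x * grad u x)"
    unfolding weak_form[symmetric] energy_def by (simp add: mult.assoc spow_mult_self)
  also have "\<dots> = (\<Sum>x\<in>\<Omega>. lam * (\<nu> x * (spow p (u x) * u x)))"
    using assms by (intro sum.cong) (auto simp: solves_def)
  finally show ?thesis
    by (simp add: spow_mult_self mass_def sum_distrib_left)
qed

lemma solves_uminus: "solves lam u \<Longrightarrow> solves lam (\<lambda>x. - u x)"
proof -
  have "grad (\<lambda>x. - u x) x = - grad u x" for x
  proof -
    have *: "- u x - u y = - (u x + u y)" for y by simp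
    show ?thesis by (simp add: grad_def * spow_minus sum_negf del: minus_add_distrib)
  qed
  then show "solves lam u \<Longrightarrow> solves lam (\<lambda>x. - u x)"
    by (simp add: solves_def spow_minus)
qed

lemma mass_pos: "nonzero_on \<Omega> u \<Longrightarrow> 0 < mass u"
  unfolding mass_def nonzero_on_def using fin nu_pos
  by (fastforce intro: sum_pos2 mult_pos_pos mult_nonneg_nonneg less_imp_le)

lemma energy_scale: "energy (\<lambda>x. c * u x) = \<bar>c\<bar> powr p * energy u"
proof -
  have "\<bar>c * u x + c * u y\<bar> powr p = \<bar>c\<bar> powr p * \<bar>u x + u y\<bar> powr p" for x y
    by (simp add: powr_mult abs_mult flip: distrib_left)
  then show ?thesis
    by (simp add: energy_def powr_mult abs_mult sum_distrib_left distrib_left mult_ac)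
qed

lemma mass_scale: "mass (\<lambda>x. c * u x) = \<bar>c\<bar> powr p * mass u"
  by (simp add: mass_def powr_mult abs_mult sum_distrib_left mult_ac)

section \<open>A positive solution determines the maximum\<close>

text \<open>
  Testing the equation of \<open>u\<close> with \<open>d = \<bar>v\<bar>\<^sup>p / u\<^sup>p\<^sup>-\<^sup>1\<close> turns \<open>spow p (u x) * d x\<close> into
  \<open>\<bar>v x\<bar>\<^sup>p\<close>. Therefore the right-hand side of the equation becomes \<open>lam * mass v\<close>, the potential
  terms cancel against those of \<open>energy v\<close>, and only the edge terms remain.
\<close>

lemma picone_identity:
  assumes u: "solves lam u" "\<forall>x\<in>\<Omega>. 0 < u x"
  shows "lam * mass v - energy v =
    (\<Sum>x\<in>\<Omega>. \<Sum>y\<in>\<Omega>. w x y * ((u x + u y) powr (p - 1) *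
        (\<bar>v x\<bar> powr p / u x powr (p - 1) + \<bar>v y\<bar> powr p / u y powr (p - 1))
        - \<bar>v x + v y\<bar> powr p)) / 2"
proof -
  define d where "d x = \<bar>v x\<bar> powr p / u x powr (p - 1)" for x
  have d: "spow p (u x) * d x = \<bar>v x\<bar> powr p" if "x \<in> \<Omega>" for x
    using bspec[OF u(2) that] by (simp add: d_def spow_pos)
  have pair: "spow p (u x + u y) = (u x + u y) powr (p - 1)" if "x \<in> \<Omega>" "y \<in> \<Omega>" for x y
    using u(2) that by (intro spow_pos add_pos_pos) auto
  have "lam * mass v = (\<Sum>x\<in>\<Omega>. lam * \<nu> x * (spow p (u x) * d x))"
    by (simp add: mass_def sum_distrib_left d mult.assoc)
  also have "\<dots> = (\<Sum>x\<in>\<Omega>. d x * grad u x)"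
    using u(1) by (intro sum.cong) (auto simp: solves_def)
  also have "\<dots> = (\<Sum>x\<in>\<Omega>. \<Sum>y\<in>\<Omega>. w x y * ((u x + u y) powr (p - 1) * (d x + d y))) / 2
      + (\<Sum>x\<in>\<Omega>. \<kappa> x * \<bar>v x\<bar> powr p)"
    unfolding weak_form[symmetric]
    by (intro arg_cong2[where f = "(+)"] arg_cong2[where f = "(/)"] sum.cong refl)
      (simp_all add: pair d mult.assoc)
  finally show ?thesis
    by (simp add: energy_def d_def right_diff_distrib sum_subtractf diff_divide_distrib)
qed

text \<open>
  By \<open>picone_pair\<close> every summand of \<open>picone_identity\<close> is nonnegative. So the eigenvalue of a
  positive solution bounds every Rayleigh quotient.
\<close>

lemma energy_le_positive_solution:
  assumes u: "solves lam u" "\<forall>x\<in>\<Omega>. 0 < u x"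
  shows "energy v \<le> lam * mass v"
proof -
  have "0 \<le> lam * mass v - energy v"
    unfolding picone_identity[OF u]
    using p_gt u(2) w_nonneg
    by (intro divide_nonneg_nonneg sum_nonneg mult_nonneg_nonneg) (auto intro: picone_pair(1))
  then show ?thesis by simp
qed

text \<open>
  If the bound is attained, all summands of \<open>picone_identity\<close> vanish. The equality case of
  \<open>picone_pair\<close> then makes \<open>v / u\<close> constant along edges, and connectedness makes it constant.
  In particular every nonzero maximizer has one sign.
\<close>

lemma maximizer_proportional:
  assumes u: "solves lam u" "\<forall>x\<in>\<Omega>. 0 < u x"
    and v: "energy v = lam * mass v"
  shows "\<exists>c. \<forall>x\<in>\<Omega>. v x = c * u x"
proof -
  define gap where "gap x y = w x y * ((u x + u y) powr (p - 1) *
        (\<bar>v x\<bar> powr p / u x powr (p - 1) + \<bar>v y\<bar> powr p / u y powr (p - 1))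
        - \<bar>v x + v y\<bar> powr p)" for x y
  have nn: "gap x y \<ge> 0" if "x \<in> \<Omega>" "y \<in> \<Omega>" for x y
    unfolding gap_def using that p_gt u(2) w_nonneg
    by (intro mult_nonneg_nonneg) (auto intro: picone_pair(1))
  have "(\<Sum>x\<in>\<Omega>. \<Sum>y\<in>\<Omega>. gap x y) = 0"
    using picone_identity[OF u, of v] v by (simp add: gap_def)
  then have zero: "gap x y = 0" if "x \<in> \<Omega>" "y \<in> \<Omega>" for x y
    using that fin nn by (simp add: sum_nonneg_eq_0_iff sum_nonneg)
  have edge: "v x * u y = v y * u x" if "x \<in> \<Omega>" "y \<in> \<Omega>" "0 < w x y" for x y
  proof (rule picone_pair(2)[OF p_gt])
    show "\<bar>v x + v y\<bar> powr p = (u x + u y) powr (p - 1) *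
        (\<bar>v x\<bar> powr p / u x powr (p - 1) + \<bar>v y\<bar> powr p / u y powr (p - 1))"
      using zero[OF that(1,2)] that(3) by (simp add: gap_def)
  qed (use u that in auto)
  obtain z where z: "z \<in> \<Omega>" using ne by auto
  have "v x / u x = v z / u z" if "x \<in> \<Omega>" for x
  proof (rule edge_propagation[OF z that])
    fix a b assume ab: "a \<in> \<Omega>" "b \<in> \<Omega>" "0 < w a b" and a: "v a / u a = v z / u z"
    have "v a / u a = v b / u b"
      using edge[OF ab] bspec[OF u(2) ab(1)] bspec[OF u(2) ab(2)] by (simp add: field_simps)
    then show "v b / u b = v z / u z" using a by simp
  qed simp
  then have "\<forall>x\<in>\<Omega>. v x = (v z / u z) * u x"
    using u(2) by (metis less_irrefl nonzero_eq_divide_eq)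
  then show ?thesis by blast
qed

section \<open>Existence of a positive solution\<close>

text \<open>
  By homogeneity it suffices to maximize \<open>energy / mass\<close> over the functions of \<open>l1\<close>-norm \<open>1\<close>.
  To have a compact set in the product topology of all functions on the vertex type, the
  functions are required to vanish outside \<open>\<Omega>\<close>; the values there do not affect \<open>energy\<close> and
  \<open>mass\<close>.
\<close>

lemma maximizer_exists:
  "\<exists>u lam. nonzero_on \<Omega> u \<and> energy u = lam * mass u \<and> (\<forall>v. energy v \<le> lam * mass v)"
proof -
  define B :: "('v \<Rightarrow> real) set" where "B = (\<Pi>\<^sub>E x\<in>UNIV. if x \<in> \<Omega> then {-1..1} else {0})"
  define S where "S = B \<inter> {u. (\<Sum>x\<in>\<Omega>. \<bar>u x\<bar>) = 1}"
  \<comment> \<open>Tychonoff's theorem; the normalization implies the bounds in \<open>B\<close>.\<close>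
  have "compact B"
    unfolding B_def compactin_euclidean_iff[symmetric] euclidean_product_topology[symmetric]
    by (subst compactin_PiE) auto
  moreover have "closed {u :: 'v \<Rightarrow> real. (\<Sum>x\<in>\<Omega>. \<bar>u x\<bar>) = 1}"
    by (intro closed_Collect_eq continuous_on_sum continuous_on_rabs continuous_on_const
        continuous_on_product_coordinates)
  ultimately have compact: "compact S"
    unfolding S_def by (rule compact_Int_closed)
  have nz: "nonzero_on \<Omega> u" if "u \<in> S" for u
  proof (rule ccontr)
    assume "\<not> nonzero_on \<Omega> u"
    then have "(\<Sum>x\<in>\<Omega>. \<bar>u x\<bar>) = 0" by (simp add: nonzero_on_def)
    then show False using that by (simp add: S_def)
  qed
  have normal: "\<exists>c>0. (\<lambda>x. c * zero_ext \<Omega> v x) \<in> S" if v: "nonzero_on \<Omega> v" for v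
  proof -
    define s where "s = (\<Sum>x\<in>\<Omega>. \<bar>v x\<bar>)"
    have s: "s > 0"
    proof -
      obtain y where "y \<in> \<Omega>" "0 < \<bar>v y\<bar>" using v by (auto simp: nonzero_on_def)
      with fin show ?thesis unfolding s_def by (intro sum_pos2) auto
    qed
    have le: "\<bar>v x\<bar> \<le> s" if "x \<in> \<Omega>" for x
      unfolding s_def using that fin by (intro member_le_sum) auto
    have "(\<Sum>x\<in>\<Omega>. \<bar>1 / s * zero_ext \<Omega> v x\<bar>) = (\<Sum>x\<in>\<Omega>. \<bar>v x\<bar> / s)"
      using s by (intro sum.cong) (auto simp: zero_ext_def)
    also have "\<dots> = 1"
      using s by (simp add: s_def flip: sum_divide_distrib)
    moreover have "1 / s * zero_ext \<Omega> v x \<in> (if x \<in> \<Omega> then {-1..1} else {0})" for x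
      using s le[of x] by (auto simp: zero_ext_def field_simps)
    ultimately have "(\<lambda>x. 1 / s * zero_ext \<Omega> v x) \<in> S"
      by (auto simp: S_def B_def)
    then show ?thesis using s by (intro exI[of _ "1 / s"]) auto
  qed
  have "S \<noteq> {}"
    using normal[of "\<lambda>_. 1"] ne by (auto simp: nonzero_on_def)
  moreover have "continuous_on S (\<lambda>u. energy u / mass u)"
  proof -
    have coord: "continuous_on S (\<lambda>u. u x)" for x
      by (rule continuous_on_product_coordinates[THEN continuous_on_subset]) simp
    have pow: "continuous_on S (\<lambda>u. \<bar>h u\<bar> powr p)" if "continuous_on S h" for h
      using p_gt that by (intro continuous_on_powr' continuous_intros) auto
    have "continuous_on S energy"
      unfolding energy_def
      by (intro continuous_on_add continuous_on_divide continuous_on_sum continuous_on_mult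
          continuous_on_const pow coord) simp
    moreover have "continuous_on S mass"
      unfolding mass_def by (intro continuous_on_sum continuous_on_mult continuous_on_const pow coord)
    moreover have "\<forall>u\<in>S. mass u \<noteq> 0"
    proof
      fix u assume "u \<in> S"
      from mass_pos[OF nz[OF this]] show "mass u \<noteq> 0" by simp
    qed
    ultimately show ?thesis by (rule continuous_on_divide)
  qed
  ultimately have "\<exists>u\<in>S. \<forall>v\<in>S. energy v / mass v \<le> energy u / mass u"
    by (rule continuous_attains_sup[OF compact])
  then obtain u where u: "u \<in> S" "\<And>v. v \<in> S \<Longrightarrow> energy v / mass v \<le> energy u / mass u"
    by blast
  define lam where "lam = energy u / mass u"
  have "energy v \<le> lam * mass v" for v
  proof (cases "nonzero_on \<Omega> v")
    case True
    then obtain c where c: "c > 0" "(\<lambda>x. c * zero_ext \<Omega> v x) \<in> S" using normal by blast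
    have ext: "energy (zero_ext \<Omega> v) = energy v" "mass (zero_ext \<Omega> v) = mass v"
      by (auto simp: energy_def mass_def zero_ext_def intro!: sum.cong arg_cong2[where f = "(+)"])
    have "energy v / mass v \<le> lam"
      using u(2)[OF c(2)] c(1) unfolding energy_scale mass_scale ext lam_def by simp
    then show ?thesis using mass_pos[OF True] by (simp add: field_simps)
  next
    case False
    then have "v x = 0" if "x \<in> \<Omega>" for x using that by (auto simp: nonzero_on_def)
    then show ?thesis by (simp add: energy_def mass_def)
  qed
  moreover have "energy u = lam * mass u"
    using mass_pos[OF nz[OF u(1)]] by (simp add: lam_def)
  ultimately show ?thesis using nz[OF u(1)] by blast
qed

lemma first_variation:
  "((\<lambda>t. energy (\<lambda>x. u x + t * d x)) has_real_derivative p * (\<Sum>x\<in>\<Omega>. d x * grad u x)) (at 0)"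
proof -
  have pair: "((\<lambda>t. \<bar>(u x + t * d x) + (u y + t * d y)\<bar> powr p)
      has_real_derivative p * spow p (u x + u y) * (d x + d y)) (at 0)" for x y
    using DERIV_abs_powr_line[OF p_gt, of "u x + u y" "d x + d y"] by (simp add: algebra_simps)
  have "((\<lambda>t. energy (\<lambda>x. u x + t * d x)) has_real_derivative
      (\<Sum>x\<in>\<Omega>. \<Sum>y\<in>\<Omega>. w x y * (p * spow p (u x + u y) * (d x + d y))) / 2
       + (\<Sum>x\<in>\<Omega>. \<kappa> x * (p * spow p (u x) * d x))) (at 0)"
    unfolding energy_def
    by (intro DERIV_add DERIV_cdivide DERIV_sum DERIV_cmult DERIV_abs_powr_line[OF p_gt] pair)
  then show ?thesis
    unfolding weak_form[symmetric] by (simp add: distrib_left sum_distrib_left mult_ac)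
qed

lemma mass_variation:
  "((\<lambda>t. mass (\<lambda>x. u x + t * d x)) has_real_derivative p * (\<Sum>x\<in>\<Omega>. d x * (\<nu> x * spow p (u x)))) (at 0)"
proof -
  have "((\<lambda>t. mass (\<lambda>x. u x + t * d x)) has_real_derivative
      (\<Sum>x\<in>\<Omega>. \<nu> x * (p * spow p (u x) * d x))) (at 0)"
    unfolding mass_def by (intro DERIV_sum DERIV_cmult DERIV_abs_powr_line[OF p_gt])
  then show ?thesis by (simp add: sum_distrib_left mult_ac)
qed

text \<open>
  The function \<open>energy - lam * mass\<close> has its maximum \<open>0\<close> at \<open>u\<close>; the equation at \<open>z\<close> is the
  vanishing of its derivative in the direction of the indicator function of \<open>z\<close>.
\<close>

lemma maximizer_solves:
  assumes "energy u = lam * mass u" and max: "\<And>v. energy v \<le> lam * mass v"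
  shows "solves lam u"
  unfolding solves_def
proof
  fix z assume z: "z \<in> \<Omega>"
  define d :: "'v \<Rightarrow> real" where "d x = of_bool (x = z)" for x
  let ?g = "\<lambda>t. energy (\<lambda>x. u x + t * d x) - lam * mass (\<lambda>x. u x + t * d x)"
  have pick: "(\<Sum>x\<in>\<Omega>. d x * h x) = h z" for h
    using fin z by (simp add: d_def)
  have "(?g has_real_derivative p * grad u z - lam * (p * (\<nu> z * spow p (u z)))) (at 0)"
    using DERIV_diff[OF first_variation[of u d] DERIV_cmult[OF mass_variation[of u d], of lam]]
    by (simp add: pick)
  then have "p * grad u z - lam * (p * (\<nu> z * spow p (u z))) = 0"
    by (rule DERIV_local_max[where d = 1]) (use assms in auto)
  then show "grad u z = lam * \<nu> z * spow p (u z)"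
    using p_gt by (simp add: algebra_simps)
qed

text \<open>
  A minimum principle: at a zero of \<open>u\<close> the equation says that a sum of nonnegative terms
  \<open>w x y * spow p (u y)\<close> is zero, so \<open>u\<close> vanishes at all neighbours too and, by connectedness,
  everywhere.
\<close>

lemma nonneg_solution_pos:
  assumes u: "solves lam u" "nonzero_on \<Omega> u" "\<And>x. x \<in> \<Omega> \<Longrightarrow> 0 \<le> u x" and x: "x \<in> \<Omega>"
  shows "0 < u x"
proof (rule ccontr)
  assume "\<not> 0 < u x"
  then have "u x = 0" using u(3)[OF x] by simp
  have "u y = 0" if y: "y \<in> \<Omega>" for y
  proof (rule edge_propagation[OF x y])
    fix a b assume ab: "a \<in> \<Omega>" "b \<in> \<Omega>" "0 < w a b" and a: "u a = 0"
    have "(\<Sum>y\<in>\<Omega>. w a y * spow p (u y)) = 0"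
      using u(1) ab(1) a by (auto simp: solves_def grad_def)
    moreover have "0 \<le> w a y * spow p (u y)" if "y \<in> \<Omega>" for y
      using that u(3) w_nonneg ab(1) by (simp add: spow_def)
    ultimately have "w a b * spow p (u b) = 0"
      using fin ab(2) by (simp add: sum_nonneg_eq_0_iff)
    then show "u b = 0" using ab(3) by (simp add: spow_def)
  qed fact
  then show False using u(2) by (auto simp: nonzero_on_def)
qed

text \<open>
  The absolute value of a maximizer is again a maximizer, because
  \<open>\<bar>u x + u y\<bar> \<le> \<bar>\<bar>u x\<bar> + \<bar>u y\<bar>\<bar>\<close>.
\<close>

lemma positive_solution_exists:
  "\<exists>u lam. solves lam u \<and> (\<forall>x\<in>\<Omega>. 0 < u x)"
proof -
  obtain u lam where u: "nonzero_on \<Omega> u" "energy u = lam * mass u"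
    and max: "\<And>v. energy v \<le> lam * mass v"
    using maximizer_exists by blast
  define a where "a x = \<bar>u x\<bar>" for x
  have "energy u \<le> energy a"
    unfolding energy_def a_def abs_idempotent using p_gt w_nonneg
    by (intro add_mono[OF _ order_refl] divide_right_mono sum_mono mult_left_mono powr_mono2) auto
  moreover have "mass a = mass u" by (simp add: mass_def a_def)
  ultimately have "energy a = lam * mass a" using u(2) max[of a] by simp
  then have a: "solves lam a" using max by (rule maximizer_solves)
  moreover have "nonzero_on \<Omega> a" using u(1) by (simp add: nonzero_on_def a_def)
  ultimately have "\<forall>x\<in>\<Omega>. 0 < a x"
    using nonneg_solution_pos[of lam a] by (simp add: a_def)
  with a show ?thesis by blast
qed

text \<open>
  By connectedness \<open>u\<close> has one sign, so either \<open>u\<close> or \<open>-u\<close> is a positive solution.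
\<close>

lemma positive_solution_of_edge_sign:
  assumes u: "solves lam u" "nonzero_on \<Omega> u"
    and edge: "\<And>x y. x \<in> \<Omega> \<Longrightarrow> y \<in> \<Omega> \<Longrightarrow> 0 < w x y \<Longrightarrow> 0 < u x * u y"
  shows "\<exists>v. solves lam v \<and> (\<forall>x\<in>\<Omega>. 0 < v x)"
proof -
  obtain z where z: "z \<in> \<Omega>" "u z \<noteq> 0" using u(2) by (auto simp: nonzero_on_def)
  have same: "0 < u z * u x" if "x \<in> \<Omega>" for x
  proof (rule edge_propagation[OF z(1) that])
    show "0 < u z * u z" using z(2) not_real_square_gt_zero by blast
    fix a b assume "a \<in> \<Omega>" "b \<in> \<Omega>" "0 < w a b" "0 < u z * u a"
    then show "0 < u z * u b" using edge[of a b] by (auto simp: zero_less_mult_iff)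
  qed
  show ?thesis
  proof (cases "0 < u z")
    case True
    then show ?thesis using u(1) same by (metis zero_less_mult_pos)
  next
    case False
    then have "0 < - u x" if "x \<in> \<Omega>" for x
      using same[OF that] by (simp add: zero_less_mult_iff)
    then show ?thesis using solves_uminus[OF u(1)] by blast
  qed
qed

end

section \<open>From the Dirichlet p-Laplacian to the signless energy\<close>

definition boundary_nbrs :: "'v wgraph \<Rightarrow> 'v set \<Rightarrow> 'v set" where
  "boundary_nbrs G \<Omega> = {y \<in> verts G - \<Omega>. \<exists>x\<in>\<Omega>. adj G x y}"

text \<open>
  The total weight of the edges from \<open>x\<close> out of \<open>\<Omega>\<close>, for \<open>x\<close> in \<open>\<Omega>\<close>. As functions are
  extended by zero, these edges act as a potential at \<open>x\<close>.
\<close>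

definition killing :: "'v wgraph \<Rightarrow> 'v set \<Rightarrow> 'v \<Rightarrow> real" where
  "killing G \<Omega> x = (\<Sum>y\<in>boundary_nbrs G \<Omega>. emu G x y)"

lemma adj_sym: "adj G x y = adj G y x"
  by (simp add: adj_def insert_commute)

lemma emu_eq_0:
  "weighted_graph G \<Longrightarrow> x \<in> verts G \<Longrightarrow> y \<in> verts G \<Longrightarrow> \<not> adj G x y \<Longrightarrow> emu G x y = 0"
  by (simp add: weighted_graph_def)

lemma emu_sym:
  "weighted_graph G \<Longrightarrow> x \<in> verts G \<Longrightarrow> y \<in> verts G \<Longrightarrow> emu G x y = emu G y x"
  by (simp add: weighted_graph_def)

lemma finite_boundary_nbrs:
  assumes "weighted_graph G" "\<Omega> \<subseteq> verts G" "finite \<Omega>"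
  shows "finite (boundary_nbrs G \<Omega>)"
proof (rule finite_subset)
  show "boundary_nbrs G \<Omega> \<subseteq> (\<Union>x\<in>\<Omega>. {y \<in> verts G. adj G x y})"
    by (auto simp: boundary_nbrs_def)
  show "finite (\<Union>x\<in>\<Omega>. {y \<in> verts G. adj G x y})"
    using assms unfolding weighted_graph_def by (intro finite_UN_I) blast+
qed

text \<open>
  Only \<open>\<Omega>\<close> and its finitely many outer neighbours contribute to the sum over all vertices. On
  the outer neighbours the extended function is zero, so the difference there is \<open>- f x\<close>.
\<close>

lemma p_laplacian_eq:
  assumes G: "weighted_graph G" and \<Omega>: "\<Omega> \<subseteq> verts G" "finite \<Omega>" and x: "x \<in> \<Omega>"
  shows "p_laplacian G \<Omega> p f x =
    1 / vnu G x * ((\<Sum>y\<in>\<Omega>. emu G x y * spow p (f y - f x)) - killing G \<Omega> x * spow p (f x))"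
proof -
  let ?B = "boundary_nbrs G \<Omega>"
  have B: "finite ?B" "?B \<subseteq> verts G" "\<Omega> \<inter> ?B = {}"
    using finite_boundary_nbrs[OF G \<Omega>] by (auto simp: boundary_nbrs_def)
  let ?F = "\<lambda>y. emu G x y * \<bar>zero_ext \<Omega> f y - zero_ext \<Omega> f x\<bar> powr (p - 2)
      * (zero_ext \<Omega> f y - zero_ext \<Omega> f x)"
  have "(\<Sum>\<^sub>\<infinity>y\<in>verts G. ?F y) = (\<Sum>\<^sub>\<infinity>y\<in>\<Omega> \<union> ?B. ?F y)"
  proof (rule infsum_cong_neutral)
    fix y assume y: "y \<in> verts G - (\<Omega> \<union> ?B)"
    then have "\<not> adj G x y" using x by (auto simp: boundary_nbrs_def)
    then have "emu G x y = 0" using emu_eq_0[OF G] y x \<Omega>(1) by blast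
    then show "?F y = 0" by simp
  qed (use B(2) \<Omega>(1) in blast)+
  also have "\<dots> = (\<Sum>y\<in>\<Omega>. ?F y) + (\<Sum>y\<in>?B. ?F y)"
    using B \<Omega> by (simp add: sum.union_disjoint)
  also have "(\<Sum>y\<in>\<Omega>. ?F y) = (\<Sum>y\<in>\<Omega>. emu G x y * spow p (f y - f x))"
    using x by (intro sum.cong) (auto simp: zero_ext_def spow_def)
  also have "(\<Sum>y\<in>?B. ?F y) = (\<Sum>y\<in>?B. - emu G x y * spow p (f x))"
    using x B by (intro sum.cong) (auto simp: zero_ext_def spow_def)
  also have "\<dots> = - killing G \<Omega> x * spow p (f x)"
    by (simp add: killing_def sum_distrib_right sum_negf)
  finally show ?thesis by (simp add: p_laplacian_def)
qed

text \<open>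
  An ordered edge contributes only if one of its ends lies in \<open>\<Omega>\<close>. Each edge leaving \<open>\<Omega>\<close>
  occurs in both orientations, which cancels the factor \<open>1/2\<close> in front of the potential term.
\<close>

lemma p_energy_eq:
  assumes G: "weighted_graph G" and \<Omega>: "\<Omega> \<subseteq> verts G" "finite \<Omega>"
  shows "p_energy G \<Omega> p f =
    (\<Sum>x\<in>\<Omega>. \<Sum>y\<in>\<Omega>. emu G x y * \<bar>f y - f x\<bar> powr p) / 2
      + (\<Sum>x\<in>\<Omega>. killing G \<Omega> x * \<bar>f x\<bar> powr p)"
proof -
  let ?B = "boundary_nbrs G \<Omega>"
  have B: "finite ?B" "?B \<subseteq> verts G" "\<Omega> \<inter> ?B = {}"
    using finite_boundary_nbrs[OF G \<Omega>] by (auto simp: boundary_nbrs_def)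
  let ?F = "\<lambda>x y. \<bar>zero_ext \<Omega> f y - zero_ext \<Omega> f x\<bar> powr p * emu G x y"
  let ?E = "{(x, y). x \<in> verts G \<and> y \<in> verts G \<and> adj G x y}"
  let ?W = "\<Omega> \<union> ?B"
  have "(\<Sum>\<^sub>\<infinity>(x, y)\<in>?E. ?F x y) = (\<Sum>\<^sub>\<infinity>(x, y)\<in>?W \<times> ?W. ?F x y)"
  proof (rule infsum_cong_neutral)
    fix e assume "e \<in> ?W \<times> ?W - ?E"
    moreover obtain x y where "e = (x, y)" by fastforce
    ultimately have "e = (x, y)" "x \<in> verts G" "y \<in> verts G" "\<not> adj G x y"
      using B \<Omega> by auto
    then show "(case e of (x, y) \<Rightarrow> ?F x y) = 0" using emu_eq_0[OF G] by simp
  next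
    fix e assume "e \<in> ?E - ?W \<times> ?W"
    then obtain x y where "e = (x, y)" "x \<in> verts G" "y \<in> verts G" "adj G x y" "x \<notin> ?W \<or> y \<notin> ?W"
      by auto
    moreover from this have "x \<notin> \<Omega>" "y \<notin> \<Omega>"
      using adj_sym[of G x y] by (auto simp: boundary_nbrs_def)
    ultimately show "(case e of (x, y) \<Rightarrow> ?F x y) = 0" by (simp add: zero_ext_def)
  qed simp
  also have "\<dots> = (\<Sum>x\<in>?W. \<Sum>y\<in>?W. ?F x y)"
    using B \<Omega> by (simp add: sum.cartesian_product)
  also have "\<dots> = (\<Sum>x\<in>\<Omega>. \<Sum>y\<in>\<Omega>. ?F x y) + (\<Sum>x\<in>\<Omega>. \<Sum>y\<in>?B. ?F x y)
      + ((\<Sum>x\<in>?B. \<Sum>y\<in>\<Omega>. ?F x y) + (\<Sum>x\<in>?B. \<Sum>y\<in>?B. ?F x y))"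
    using B \<Omega> by (simp add: sum.union_disjoint sum.distrib)
  also have "(\<Sum>x\<in>?B. \<Sum>y\<in>?B. ?F x y) = 0"
    using B by (intro sum.neutral ballI) (auto simp: zero_ext_def)
  also have "(\<Sum>x\<in>?B. \<Sum>y\<in>\<Omega>. ?F x y) = (\<Sum>y\<in>\<Omega>. \<Sum>x\<in>?B. ?F x y)"
    by (rule sum.swap)
  also have "\<dots> = (\<Sum>x\<in>\<Omega>. \<Sum>y\<in>?B. ?F x y)"
  proof (intro sum.cong refl)
    fix x y assume "x \<in> \<Omega>" "y \<in> ?B"
    then have "emu G y x = emu G x y" using emu_sym[OF G] B(2) \<Omega>(1) by blast
    then show "?F y x = ?F x y" by (simp add: abs_minus_commute)
  qed
  also have "(\<Sum>x\<in>\<Omega>. \<Sum>y\<in>?B. ?F x y) = (\<Sum>x\<in>\<Omega>. killing G \<Omega> x * \<bar>f x\<bar> powr p)"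
    unfolding killing_def sum_distrib_right using B
    by (intro sum.cong refl) (auto simp: zero_ext_def)
  also have "(\<Sum>x\<in>\<Omega>. \<Sum>y\<in>\<Omega>. ?F x y) = (\<Sum>x\<in>\<Omega>. \<Sum>y\<in>\<Omega>. emu G x y * \<bar>f y - f x\<bar> powr p)"
    by (intro sum.cong refl) (auto simp: zero_ext_def)
  finally show ?thesis by (simp add: p_energy_def)
qed

theorem theorem1p2:
  fixes G :: "'v wgraph" and \<Omega> :: "'v set" and p :: real
  assumes "weighted_graph G"
    and "\<Omega> \<subseteq> verts G" and "finite \<Omega>" and "\<Omega> \<noteq> {}"
    and "connected_in G \<Omega>" and "bipartite_in G \<Omega>"
    and "1 < p"
  shows "(\<forall>f. eigenfunction G \<Omega> p f \<longrightarrow>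
            (max_eigenfunction G \<Omega> p f \<longleftrightarrow>
               (\<forall>x\<in>\<Omega>. \<forall>y\<in>\<Omega>. adj G x y \<longrightarrow> f x * f y < 0)))
       \<and> (\<exists>f. max_eigenfunction G \<Omega> p f)
       \<and> (\<forall>f g. max_eigenfunction G \<Omega> p f \<longrightarrow> max_eigenfunction G \<Omega> p g \<longrightarrow>
            (\<exists>c::real. \<forall>x\<in>\<Omega>. g x = c * f x))"
proof -
  have weight: "emu G x y = emu G y x" "0 < emu G x y \<longleftrightarrow> adj G x y" "0 \<le> emu G x y"
    "\<not> adj G x y \<Longrightarrow> emu G x y = 0" "0 < vnu G x"
    if "x \<in> \<Omega>" "y \<in> \<Omega>" for x y
  proof -
    have xy: "x \<in> verts G" "y \<in> verts G" using assms(2) that by auto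
    then show "emu G x y = emu G y x" "0 < vnu G x" "\<not> adj G x y \<Longrightarrow> emu G x y = 0"
      using assms(1) by (simp_all add: weighted_graph_def)
    have "if adj G x y then 0 < emu G x y else emu G x y = 0"
      using assms(1) xy by (simp add: weighted_graph_def)
    then show "0 < emu G x y \<longleftrightarrow> adj G x y" "0 \<le> emu G x y"
      by (simp_all split: if_splits)
  qed
  have rel: "{(a, b). a \<in> \<Omega> \<and> b \<in> \<Omega> \<and> 0 < emu G a b} = {(a, b). a \<in> \<Omega> \<and> b \<in> \<Omega> \<and> adj G a b}"
    using weight(2) by auto
  interpret signless_form \<Omega> "emu G" "killing G \<Omega>" "vnu G" p
    using assms weight rel by unfold_locales (auto simp: connected_in_def)
  \<comment> \<open>\<open>s\<close> is \<open>1\<close> on one class of the bipartition and \<open>-1\<close> on the other.\<close>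
  obtain s :: "'v \<Rightarrow> real" where s: "\<And>x. s x = 1 \<or> s x = -1"
    "\<And>x y. x \<in> \<Omega> \<Longrightarrow> y \<in> \<Omega> \<Longrightarrow> adj G x y \<Longrightarrow> s y = - s x"
  proof -
    obtain V1 V2 where "V1 \<inter> V2 = {}" "\<forall>x\<in>\<Omega>. \<forall>y\<in>\<Omega>. adj G x y \<longrightarrow>
        (x \<in> V1 \<and> y \<in> V2) \<or> (x \<in> V2 \<and> y \<in> V1)"
      using assms(6) unfolding bipartite_in_def by blast
    then show thesis
      by (intro that[of "\<lambda>x. if x \<in> V1 then 1 else -1"]) (auto; blast)+
  qed
  define flip where "flip f = (\<lambda>x. s x * f x)" for f :: "'v \<Rightarrow> real"
  have ss: "s x * s x = 1" "\<bar>s x\<bar> = 1" "s x \<noteq> 0" for x using s(1)[of x] by auto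
  have flip_flip: "flip (flip f) = f" for f
    by (simp add: flip_def fun_eq_iff ss flip: mult.assoc)
  have nz: "nonzero_on \<Omega> (flip f) \<longleftrightarrow> nonzero_on \<Omega> f" for f
    by (simp add: nonzero_on_def flip_def ss)
  have diff: "f y - f x = - s x * (flip f x + flip f y)"
    if "x \<in> \<Omega>" "y \<in> \<Omega>" "adj G x y" for f x y
    using s(2)[OF that] s(1)[of x] by (auto simp: flip_def)
  have spow_s: "spow p (s x * t) = s x * spow p t" for x t
    using s(1)[of x] by (auto simp: spow_minus)
  have energy: "p_energy G \<Omega> p f = energy (flip f)" for f
  proof -
    have "emu G x y * \<bar>f y - f x\<bar> powr p = emu G x y * \<bar>flip f x + flip f y\<bar> powr p"
      if "x \<in> \<Omega>" "y \<in> \<Omega>" for x y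
      using diff[OF that, of f] weight(4)[OF that] by (cases "adj G x y") (auto simp: abs_mult ss)
    then have "(\<Sum>x\<in>\<Omega>. \<Sum>y\<in>\<Omega>. emu G x y * \<bar>f y - f x\<bar> powr p)
        = (\<Sum>x\<in>\<Omega>. \<Sum>y\<in>\<Omega>. emu G x y * \<bar>flip f x + flip f y\<bar> powr p)"
      by (intro sum.cong refl)
    moreover have "\<bar>flip f x\<bar> = \<bar>f x\<bar>" for x
      by (simp add: flip_def abs_mult ss)
    ultimately show ?thesis
      unfolding p_energy_eq[OF assms(1-3)] energy_def by simp
  qed
  have mass: "p_norm_pow G \<Omega> p f = mass (flip f)" for f
    by (simp add: p_norm_pow_def mass_def flip_def abs_mult ss mult.commute)
  have eigen: "eigenfunction_for G \<Omega> p lam f \<longleftrightarrow> nonzero_on \<Omega> f \<and> solves lam (flip f)" for lam f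
  proof -
    have "p_laplacian G \<Omega> p f x = - lam * \<bar>f x\<bar> powr (p - 2) * f x \<longleftrightarrow>
        grad (flip f) x = lam * vnu G x * spow p (flip f x)" if x: "x \<in> \<Omega>" for x
    proof -
      have "emu G x y * spow p (f y - f x) = - s x * (emu G x y * spow p (flip f x + flip f y))"
        if "y \<in> \<Omega>" for y
      proof (cases "adj G x y")
        case True
        then show ?thesis
          using diff[OF x that True, of f] spow_s[of x "- (flip f x + flip f y)"]
          by (simp add: spow_minus del: minus_add_distrib)
      qed (use weight(4)[OF x that] in simp)
      then have sum: "(\<Sum>y\<in>\<Omega>. emu G x y * spow p (f y - f x))
          = - s x * (\<Sum>y\<in>\<Omega>. emu G x y * spow p (flip f x + flip f y))"
        unfolding sum_distrib_left by (intro sum.cong refl)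
      have fx: "spow p (f x) = s x * spow p (flip f x)"
        using ss(1)[of x] by (simp add: flip_def spow_s flip: mult.assoc)
      have "p_laplacian G \<Omega> p f x = - s x / vnu G x * grad (flip f) x"
        unfolding p_laplacian_eq[OF assms(1-3) x] sum fx grad_def by (simp add: algebra_simps)
      moreover have "- lam * \<bar>f x\<bar> powr (p - 2) * f x = - lam * spow p (f x)"
        by (simp add: spow_def)
      moreover have "- lam * spow p (f x) = - s x / vnu G x * (lam * vnu G x * spow p (flip f x))"
        unfolding fx using weight(5)[OF x x] by simp
      moreover have "- s x / vnu G x \<noteq> 0" using weight(5)[OF x x] ss by simp
      ultimately show ?thesis by (metis mult_cancel_left)
    qed
    then show ?thesis by (simp add: eigenfunction_for_def solves_def)
  qed
  obtain u lam where u: "solves lam u" "\<forall>x\<in>\<Omega>. 0 < u x"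
    using positive_solution_exists by blast
  have max: "energy v \<le> lam * mass v" for v
    using u by (rule energy_le_positive_solution)
  have u_nz: "nonzero_on \<Omega> u"
    using u(2) ne by (fastforce simp: nonzero_on_def)
  \<comment> \<open>The eigenvalue of the positive solution is the maximum, attained at that solution.\<close>
  have lam: "max_eigenvalue G \<Omega> p = lam"
    unfolding max_eigenvalue_def
  proof (rule cSup_eq_maximum)
    have "lam = p_energy G \<Omega> p (flip u) / p_norm_pow G \<Omega> p (flip u)"
      using mass_pos[OF u_nz] energy_solution[OF u(1)] by (simp add: energy mass flip_flip)
    then show "lam \<in> (\<lambda>u. p_energy G \<Omega> p u / p_norm_pow G \<Omega> p u) ` {u. nonzero_on \<Omega> u}"
      using u_nz nz by blast
  next
    fix r assume "r \<in> (\<lambda>u. p_energy G \<Omega> p u / p_norm_pow G \<Omega> p u) ` {u. nonzero_on \<Omega> u}"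
    then obtain v where "r = energy (flip v) / mass (flip v)" "nonzero_on \<Omega> (flip v)"
      by (auto simp: energy mass nz)
    then show "r \<le> lam" using max[of "flip v"] mass_pos[of "flip v"]
      by (simp add: pos_divide_le_eq)
  qed
  have max_eig: "max_eigenfunction G \<Omega> p f \<longleftrightarrow> nonzero_on \<Omega> f \<and> solves lam (flip f)" for f
    by (simp add: max_eigenfunction_def eigen lam)
  have multiple: "\<exists>c. c \<noteq> 0 \<and> (\<forall>x\<in>\<Omega>. f x = c * (s x * u x))" if f: "max_eigenfunction G \<Omega> p f" for f
  proof -
    have "energy (flip f) = lam * mass (flip f)"
      using f by (intro energy_solution) (simp add: max_eig)
    then obtain c where c: "\<forall>x\<in>\<Omega>. flip f x = c * u x"
      using maximizer_proportional[OF u] by blast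
    then have "\<forall>x\<in>\<Omega>. f x = c * (s x * u x)"
      using fun_cong[OF flip_flip[of f, symmetric]] by (simp add: flip_def[of "flip f"])
    moreover have "c \<noteq> 0"
    proof
      assume "c = 0"
      then have "\<not> nonzero_on \<Omega> (flip f)" using c by (simp add: nonzero_on_def)
      then show False using f by (simp add: max_eig nz)
    qed
    ultimately show ?thesis by blast
  qed
  have sign: "max_eigenfunction G \<Omega> p f \<longleftrightarrow> (\<forall>x\<in>\<Omega>. \<forall>y\<in>\<Omega>. adj G x y \<longrightarrow> f x * f y < 0)"
    if f: "eigenfunction G \<Omega> p f" for f
  proof
    assume "max_eigenfunction G \<Omega> p f"
    then obtain c where c: "c \<noteq> 0" "\<forall>x\<in>\<Omega>. f x = c * (s x * u x)" using multiple by blast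
    show "\<forall>x\<in>\<Omega>. \<forall>y\<in>\<Omega>. adj G x y \<longrightarrow> f x * f y < 0"
    proof (intro ballI impI)
      fix x y assume xy: "x \<in> \<Omega>" "y \<in> \<Omega>" "adj G x y"
      have "f x * f y = - (c * c) * (s x * s x) * (u x * u y)"
        using c(2) xy s(2)[OF xy] by simp
      also have "\<dots> = - ((c * c) * (u x * u y))" by (simp add: ss)
      also have "\<dots> < 0"
      proof -
        have "0 < c * c" using c(1) not_real_square_gt_zero by blast
        then show ?thesis using bspec[OF u(2) xy(1)] bspec[OF u(2) xy(2)] by simp
      qed
      finally show "f x * f y < 0" .
    qed
  next
    assume neg: "\<forall>x\<in>\<Omega>. \<forall>y\<in>\<Omega>. adj G x y \<longrightarrow> f x * f y < 0"
    obtain lam' where f': "nonzero_on \<Omega> f" "solves lam' (flip f)"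
      using f by (auto simp: eigenfunction_def eigen)
    have "0 < flip f x * flip f y" if "x \<in> \<Omega>" "y \<in> \<Omega>" "0 < emu G x y" for x y
    proof -
      have a: "adj G x y" using that weight(2) by blast
      have "flip f x * flip f y = - (s x * s x) * (f x * f y)"
        using s(2)[OF that(1,2) a] by (simp add: flip_def)
      then show ?thesis using neg that a by (simp add: ss)
    qed
    then have "\<exists>v. solves lam' v \<and> (\<forall>x\<in>\<Omega>. 0 < v x)"
      using f' by (intro positive_solution_of_edge_sign[OF f'(2)]) (simp_all add: nz)
    then obtain v where v: "solves lam' v" "\<forall>x\<in>\<Omega>. 0 < v x"
      by blast
    \<comment> \<open>Both \<open>lam\<close> and \<open>lam'\<close> belong to positive solutions, so each of them bounds the
      Rayleigh quotients and they agree.\<close>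
    have "lam * mass u \<le> lam' * mass u"
      using energy_le_positive_solution[OF v, of u] energy_solution[OF u(1)] by simp
    moreover have "lam' * mass (flip f) \<le> lam * mass (flip f)"
      using max[of "flip f"] energy_solution[OF f'(2)] by simp
    moreover have "0 < mass (flip f)"
      using f'(1) nz by (intro mass_pos) simp
    ultimately have "lam' = lam"
      using mass_pos[OF u_nz] by simp
    then show "max_eigenfunction G \<Omega> p f" using f' by (simp add: max_eig)
  qed
  have exists: "max_eigenfunction G \<Omega> p (flip u)"
    using u(1) u_nz by (simp add: max_eig flip_flip nz)
  have unique: "\<exists>c. \<forall>x\<in>\<Omega>. g x = c * f x"
    if f: "max_eigenfunction G \<Omega> p f" and g: "max_eigenfunction G \<Omega> p g" for f g
  proof -
    obtain a where "a \<noteq> 0" "\<forall>x\<in>\<Omega>. f x = a * (s x * u x)"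
      using multiple[OF f] by blast
    moreover obtain b where "\<forall>x\<in>\<Omega>. g x = b * (s x * u x)"
      using multiple[OF g] by blast
    ultimately show ?thesis by (intro exI[of _ "b / a"]) simp
  qed
  show ?thesis
    by (intro conjI allI impI sign exI[of _ "flip u"] exists unique)
qed

end
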